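(* Let $\lambda^1>\dots>\lambda^t>0$ and $\epsilon>0$ be given. The solution path $(w^*(\lambda^1),v^*(\lambda^1)),\dots,(w^*(\lambda^t),v^*(\lambda^t))$ obtained by the adaptive sieving algorithm (described in the context) consists of approximate optimal solutions of the problems $(P_{\lambda^1}),\dots,(P_{\lambda^t})$, respectively; that is, for every $i=1,\dots,t$, for the $(w^*(\lambda^i),v^*(\lambda^i))$ and $y^*(\lambda^i)$ obtained by the algorithm, there exists $u^*(\lambda^i)$ satisfying $$\mathrm{Res}_{\lambda^i}(w^*(\lambda^i),v^*(\lambda^i),y^*(\lambda^i),u^*(\lambda^i))\le\epsilon.$$
   Context: Problem. Data: $(a_i,b_i)\in\mathbb{R}^n\times\{-1,1\}$, $i=1,\dots,m$; $A=[a_1,\dots,a_m]^\top\in\mathbb{R}^{m\times n}$; $\mathbf{1}_m$ is the all-ones vector; $h(x)=\frac1m\sum_{i=1}^m\log(1+\exp(-b_ix_i))$ for $x\in\mathbb{R}^m$. For $\lambda>0$, $(P_\lambda)$ is the problem $\min_{w\in\mathbb{R}^n,v\in\mathbb{R}}\ h(Aw+v\mathbf{1}_m)+\lambda\|w\|_1$. The optimal solution set of $(P_\lambda)$ is assumed nonempty and compact. Notation. $\mathrm{Prox}_{\lambda\|\cdot\|_1}(x)=\mathrm{sgn}(x)\circ\max\{|x|-\lambda\mathbf{1},0\}$ (componentwise soft thresholding). $\mathcal{B}_\infty=\{x\in\mathbb{R}^n:\|x\|_\infty\le1\}$. For an index set $I\subseteq\{1,\dots,n\}$, $\bar I$ is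 its complement, $|I|$ its cardinality, $A_I$ the submatrix of the columns of $A$ indexed by $I$, $w_I$ the subvector of $w$ indexed by $I$. For a set $\mathcal{D}\subseteq\mathbb{R}^n$, $(\mathcal{D})_j$ is the projection of $\mathcal{D}$ onto the $j$-th coordinate. $\partial\lambda\|w\|_1$ is the subdifferential of $\lambda\|\cdot\|_1$ at $w$. $\|\cdot\|$ is the Euclidean norm. KKT residuals. For $(w,v,y,u)\in\mathbb{R}^n\times\mathbb{R}\times\mathbb{R}^m\times\mathbb{R}^m$, $$\mathrm{Res}_\lambda(w,v,y,u)=\max\{\|\nabla h(y)-u\|,\ \|w-\mathrm{Prox}_{\lambda\|\cdot\|_1}(w-A^\top u)\|,\ \|y-Aw-v\mathbf{1}_m\|,\ |u^\top\mathbf{1}_m|\},$$ and for $I\subseteq\{1,\dots,n\}$, $z\in\mathbb{R}^{|I|}$, $$\mathrm{Res}^I_\lambda(z,v,y,u)=\max\{\|\nabla h(y)-u\|,\ \|z-\mathrm{Prox}_{\lambda\|\cdot\|_1}(z-A_I^\top u)\|,\ \|y-A_Iz-v\mathbf{1}_m\|,\ |u^\top\mathbf{1}_m|\}.$$ Adaptive sieving algorithm. Input: $\lambda^1>\dots>\lambda^t>0$ and tolerance $\epsilon>0$. Initialization: an initial index set $I^*(\lambda^0)\subseteq\{1,\dots,n\}$ is generated by some screening rule. For $i=1,\dots,t$: 1. Set $I^0(\lambda^i)=I^*(\lambda^{i-1})$. Solve the reduced problem $\min_{z\in\mathbb{R}^{|I^0(\lambda^i)|},v\in\mathbb{R}}\{h(A_{I^0(\lambda^i)}z+v\mathbf{1}_m)+\lambda^i\|z\|_1\}$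 approximately (by the proximal point algorithm PPDNA, a solver that returns approximate solutions of the prescribed accuracy), obtaining $(z^0(\lambda^i),v^0(\lambda^i),y^0(\lambda^i),u^0(\lambda^i))$ with $\mathrm{Res}^{I^0(\lambda^i)}_{\lambda^i}(z^0(\lambda^i),v^0(\lambda^i),y^0(\lambda^i),u^0(\lambda^i))\le\epsilon/\sqrt2$. Extend $z^0(\lambda^i)$ to $w^0(\lambda^i)\in\mathbb{R}^n$ by $w^0(\lambda^i)_{I^0(\lambda^i)}=z^0(\lambda^i)$, $w^0(\lambda^i)_{\bar I^0(\lambda^i)}=0$. Set $l=0$. 2. While $\mathrm{Res}_{\lambda^i}(w^l(\lambda^i),v^l(\lambda^i),y^l(\lambda^i),u^l(\lambda^i))>\epsilon$: (a) form $$J^{l+1}(\lambda^i)=\Big\{j\in\bar I^l(\lambda^i)\ :\ -(A^\top u^l(\lambda^i))_j\notin\Big(\partial\lambda^i\|w^l(\lambda^i)\|_1+\tfrac{\epsilon}{\sqrt{2|\bar I^l(\lambda^i)|}}\mathcal{B}_\infty\Big)_j\Big\};$$ (b) set $I^{l+1}(\lambda^i)=I^l(\lambda^i)\cup J^{l+1}(\lambda^i)$; (c) solve $\min_{z\in\mathbb{R}^{|I^{l+1}(\lambda^i)|},v\in\mathbb{R}}\{h(A_{I^{l+1}(\lambda^i)}z+v\mathbf{1}_m)+\lambda^i\|z\|_1\}$ approximately (by PPDNA), obtaining $(z^{l+1}(\lambda^i),v^{l+1}(\lambda^i),y^{l+1}(\lambda^i),u^{l+1}(\lambda^i))$ with $\mathrm{Res}^{I^{l+1}(\lambda^i)}_{\lambda^i}(\cdot)\le\epsilon/\sqrt2$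 at this point, and extend $z^{l+1}(\lambda^i)$ to $w^{l+1}(\lambda^i)$ by $w^{l+1}(\lambda^i)_{I^{l+1}(\lambda^i)}=z^{l+1}(\lambda^i)$, $w^{l+1}(\lambda^i)_{\bar I^{l+1}(\lambda^i)}=0$; (d) replace $l$ by $l+1$. 3. Set $(w^*(\lambda^i),v^*(\lambda^i),y^*(\lambda^i),u^*(\lambda^i))=(w^l(\lambda^i),v^l(\lambda^i),y^l(\lambda^i),u^l(\lambda^i))$ and $I^*(\lambda^i)=I^l(\lambda^i)$. Output: the solution path $(w^*(\lambda^1),v^*(\lambda^1)),\dots,(w^*(\lambda^t),v^*(\lambda^t))$. *)

theory Defs
  imports "HOL-Analysis.Analysis" "HOL-Library.While_Combinator"
begin

definition logistic_loss :: "real^'m \<Rightarrow> real^'m \<Rightarrow> real" where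
  "logistic_loss b x = (1 / real CARD('m)) * (\<Sum>k\<in>UNIV. ln (1 + exp (- b $ k * x $ k)))"

definition l1_norm :: "real^'n \<Rightarrow> real" where
  "l1_norm w = (\<Sum>j\<in>UNIV. \<bar>w $ j\<bar>)"

(* The rows of A are the data points; 1 is the all-ones vector of real^'m. *)
definition objective :: "real^'n^'m \<Rightarrow> real^'m \<Rightarrow> real \<Rightarrow> (real^'n) \<times> real \<Rightarrow> real" where
  "objective A b lam = (\<lambda>(w, v). logistic_loss b (A *v w + v *\<^sub>R 1) + lam * l1_norm w)"

definition solution_set :: "real^'n^'m \<Rightarrow> real^'m \<Rightarrow> real \<Rightarrow> ((real^'n) \<times> real) set" where
  "solution_set A b lam = {p. is_arg_min (objective A b lam) (\<lambda>_. True) p}"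

definition gradient :: "('a::real_inner \<Rightarrow> real) \<Rightarrow> 'a \<Rightarrow> 'a" where
  "gradient f x = (THE D. GDERIV f x :> D)"

definition subdifferential :: "('a::real_inner \<Rightarrow> real) \<Rightarrow> 'a \<Rightarrow> 'a set" where
  "subdifferential f w = {g. \<forall>x. f x \<ge> f w + g \<bullet> (x - w)}"

definition soft_threshold :: "real \<Rightarrow> real \<Rightarrow> real" where
  "soft_threshold lam s = sgn s * max (\<bar>s\<bar> - lam) 0"

definition prox_l1 :: "real \<Rightarrow> real^'n \<Rightarrow> real^'n" where
  "prox_l1 lam x = (\<chi> j. soft_threshold lam (x $ j))"

definition kkt_res ::
  "real^'n^'m \<Rightarrow> real^'m \<Rightarrow> real \<Rightarrow> real^'n \<Rightarrow> real \<Rightarrow> real^'m \<Rightarrow> real^'m \<Rightarrow> real" where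
  "kkt_res A b lam w v y u =
     Max {norm (gradient (logistic_loss b) y - u),
          norm (w - prox_l1 lam (w - transpose A *v u)),
          norm (y - A *v w - v *\<^sub>R 1),
          \<bar>u \<bullet> 1\<bar>}"

(* A vector z indexed by I is a function of which only the values on I are used, so that L2_set _ I is
   its Euclidean norm; the columns of the submatrix A_I are the vectors column j A with j in I. *)
definition reduced_kkt_res ::
  "real^'n^'m \<Rightarrow> real^'m \<Rightarrow> real \<Rightarrow> 'n set \<Rightarrow> ('n \<Rightarrow> real) \<Rightarrow> real \<Rightarrow> real^'m \<Rightarrow> real^'m \<Rightarrow> real"
  where
  "reduced_kkt_res A b lam I z v y u =
     Max {norm (gradient (logistic_loss b) y - u),
          L2_set (\<lambda>j. z j - soft_threshold lam (z j - column j A \<bullet> u)) I,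
          norm (y - (\<Sum>j\<in>I. z j *\<^sub>R column j A) - v *\<^sub>R 1),
          \<bar>u \<bullet> 1\<bar>}"

(* solve lam l I is the point (z, v, y, u) that the inexact solver returns in round l of the stage
   with parameter lam, where the reduced problem has index set I. The dependence on lam and l
   leaves the solver free to answer differently at each call, e.g. because of warm starts. *)
type_synonym ('n, 'm) reduced_solver =
  "real \<Rightarrow> nat \<Rightarrow> 'n set \<Rightarrow> ('n \<Rightarrow> real) \<times> real \<times> (real^'m) \<times> (real^'m)"

definition accurate_solver ::
  "real^'n^'m \<Rightarrow> real^'m \<Rightarrow> real \<Rightarrow> ('n, 'm) reduced_solver \<Rightarrow> real \<Rightarrow> bool" where
  "accurate_solver A b tol solve lam \<longleftrightarrow>
     (\<forall>l I. case solve lam l I of (z, v, y, u) \<Rightarrow> reduced_kkt_res A b lam I z v y u \<le> tol)"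

record ('n::finite, 'm::finite) sieve_state =
  round_of :: nat
  index_of :: "'n set"
  w_of :: "real^'n"
  v_of :: real
  y_of :: "real^'m"
  u_of :: "real^'m"

definition sieve_solve ::
  "('n::finite, 'm::finite) reduced_solver \<Rightarrow> real \<Rightarrow> nat \<Rightarrow> 'n set \<Rightarrow> ('n, 'm) sieve_state" where
  "sieve_solve solve lam l I =
     (case solve lam l I of (z, v, y, u) \<Rightarrow>
        \<lparr>round_of = l, index_of = I, w_of = (\<chi> j. if j \<in> I then z j else 0),
         v_of = v, y_of = y, u_of = u\<rparr>)"

(* For I = UNIV the quotient is a division by zero, but then no j is tested. *)
definition violated ::
  "real^'n^'m \<Rightarrow> real \<Rightarrow> real \<Rightarrow> 'n set \<Rightarrow> real^'n \<Rightarrow> real^'m \<Rightarrow> 'n set" where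
  "violated A eps lam I w u =
     {j \<in> - I. - (transpose A *v u) $ j \<notin>
        (\<lambda>x. x $ j) ` {g + (eps / sqrt (2 * real (card (- I)))) *\<^sub>R d | g d.
           g \<in> subdifferential (\<lambda>x. lam * l1_norm x) w \<and> infnorm d \<le> 1}}"

definition sieve_step ::
  "real^'n^'m \<Rightarrow> real \<Rightarrow> ('n, 'm) reduced_solver \<Rightarrow> real
     \<Rightarrow> ('n, 'm) sieve_state \<Rightarrow> ('n, 'm) sieve_state" where
  "sieve_step A eps solve lam s =
     sieve_solve solve lam (Suc (round_of s))
       (index_of s \<union> violated A eps lam (index_of s) (w_of s) (u_of s))"

(* None iff the while loop does not terminate. *)
definition sieve_stage ::
  "real^'n^'m \<Rightarrow> real^'m \<Rightarrow> real \<Rightarrow> ('n, 'm) reduced_solver \<Rightarrow> 'n set \<Rightarrow> real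
     \<Rightarrow> ('n, 'm) sieve_state option" where
  "sieve_stage A b eps solve I lam =
     while_option (\<lambda>s. kkt_res A b lam (w_of s) (v_of s) (y_of s) (u_of s) > eps)
       (sieve_step A eps solve lam) (sieve_solve solve lam 0 I)"

(* The final states of the stages, in the order of the list of parameters; the index set on which
   a stage ends is the initial one of the next. None iff one of the stages does not terminate. *)
primrec adaptive_sieving ::
  "real^'n^'m \<Rightarrow> real^'m \<Rightarrow> real \<Rightarrow> ('n, 'm) reduced_solver \<Rightarrow> 'n set \<Rightarrow> real list
     \<Rightarrow> ('n, 'm) sieve_state list option" where
  "adaptive_sieving A b eps solve I [] = Some []"
| "adaptive_sieving A b eps solve I (lam # lams) =
     (case sieve_stage A b eps solve I lam of
        None \<Rightarrow> None
      | Some s \<Rightarrow> map_option (\<lambda>path. s # path)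
                    (adaptive_sieving A b eps solve (index_of s) lams))"

lemma gradient_eqI:
  assumes "GDERIV f x :> D"
  shows "gradient f x = D"
  unfolding gradient_def
proof (rule the_equality[where P = "\<lambda>D. GDERIV f x :> D", OF assms])
  fix E assume "GDERIV f x :> E"
  then have "(\<lambda>h. h \<bullet> E) = (\<lambda>h. h \<bullet> D)"
    using assms has_derivative_unique unfolding gderiv_def by blast
  then have "(E - D) \<bullet> E = (E - D) \<bullet> D" by (rule fun_cong)
  then have "(E - D) \<bullet> (E - D) = 0" by (simp add: inner_diff_right)
  then show "E = D" by simp
qed

lemma gradient_logistic_loss:
  fixes b x :: "real^'m"
  shows "GDERIV (logistic_loss b) x :> gradient (logistic_loss b) x"
proof -
  let ?g = "\<lambda>k. - b $ k * exp (- b $ k * x $ k) / (1 + exp (- b $ k * x $ k))"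
  have term_deriv: "((\<lambda>x. ln (1 + exp (- b $ k * x $ k))) has_derivative (\<lambda>h. h $ k * ?g k)) (at x)"
    for k
  proof -
    have "((\<lambda>s. ln (1 + exp (- b $ k * s))) has_real_derivative ?g k) (at (x $ k))"
      by (auto intro!: derivative_eq_intros simp: add_pos_pos)
    then have "((\<lambda>s. ln (1 + exp (- b $ k * s))) has_derivative (*) (?g k)) (at (x $ k))"
      by (simp add: has_field_derivative_def)
    from diff_chain_at[OF bounded_linear_imp_has_derivative[OF bounded_linear_vec_nth] this]
    show ?thesis by (simp add: o_def mult.commute)
  qed
  have "(logistic_loss b has_derivative
           (\<lambda>h. (1 / real CARD('m)) * (\<Sum>k\<in>UNIV. h $ k * ?g k))) (at x)"
    unfolding logistic_loss_def[abs_def]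
    by (intro has_derivative_mult_right has_derivative_sum term_deriv)
  also have "(\<lambda>h. (1 / real CARD('m)) * (\<Sum>k\<in>UNIV. h $ k * ?g k)) =
      (\<lambda>h. h \<bullet> (\<chi> k. (1 / real CARD('m)) * ?g k))"
    unfolding inner_vec_def sum_distrib_left
    by (intro ext sum.cong refl) (simp only: vec_lambda_beta inner_real_def mult.left_commute)
  finally have "GDERIV (logistic_loss b) x :> (\<chi> k. (1 / real CARD('m)) * ?g k)"
    by (simp only: gderiv_def)
  from this gradient_eqI[OF this] show ?thesis by (simp only:)
qed

end

theory Submission
  imports Defs
begin

text \<open>
  If no index outside \<open>I\<close> is violated, then each of the soft-thresholded
  coordinates outside \<open>I\<close> is at most \<open>eps / sqrt (2 * card (- I))\<close>, so together they contribute at most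
  \<open>eps\<^sup>2 / 2\<close> to the squared proximal residual; the coordinates in \<open>I\<close> contribute the other
  \<open>eps\<^sup>2 / 2\<close> because the reduced problem is solved to accuracy \<open>eps / sqrt 2\<close>. So a round
  whose residual exceeds \<open>eps\<close> strictly enlarges the index set, which is possible only finitely often.
\<close>

text \<open>Moving from \<open>w\<close> by \<open>t\<close> along axis \<open>j\<close> raises the
  l1 norm by exactly \<bar>t\<bar>, because \<open>w $ j = 0\<close>. The subgradient inequality at
  \<open>t = 1\<close> and \<open>t = -1\<close> then gives both bounds.\<close>

lemma abs_subdifferential_l1_norm_le:
  fixes w g :: "real^'n"
  assumes "g \<in> subdifferential (\<lambda>x. lam * l1_norm x) w" and "w $ j = 0"
  shows "\<bar>g $ j\<bar> \<le> lam"
proof -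
  have "l1_norm (w + axis j t) = l1_norm w + \<bar>t\<bar>" for t
  proof -
    have "(\<Sum>i\<in>UNIV. \<bar>(w + axis j t) $ i\<bar>) = (\<Sum>i\<in>UNIV. \<bar>w $ i\<bar> + (if i = j then \<bar>t\<bar> else 0))"
      using assms(2) by (intro sum.cong) (auto simp: axis_def)
    then show ?thesis by (simp add: l1_norm_def sum.distrib)
  qed
  moreover have "lam * l1_norm (w + axis j t) \<ge> lam * l1_norm w + g $ j * t" for t
    using assms(1) by (auto simp: subdifferential_def inner_axis dest: spec[of _ "w + axis j t"])
  ultimately have "g $ j * t \<le> lam * \<bar>t\<bar>" for t
    by (simp add: algebra_simps)
  from this[of 1] this[of "-1"] show ?thesis by simp
qed

lemma abs_soft_threshold:
  assumes "lam \<ge> 0"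
  shows "\<bar>soft_threshold lam s\<bar> = max (\<bar>s\<bar> - lam) 0"
  using assms by (cases "s = 0") (auto simp: soft_threshold_def abs_mult)

text \<open>The argument of the threshold is a subgradient coordinate, of modulus at most
  \<open>lam\<close>, plus a perturbation bounded by the sieving tolerance. Shrinking by
  \<open>lam\<close> leaves at most that tolerance.\<close>

lemma abs_soft_threshold_not_violated:
  fixes A :: "real^'n^'m"
  assumes "lam \<ge> 0" "eps \<ge> 0" "j \<notin> I" "w $ j = 0" "j \<notin> violated A eps lam I w u"
  shows "\<bar>soft_threshold lam (- (transpose A *v u) $ j)\<bar> \<le> eps / sqrt (2 * real (card (- I)))"
proof -
  define c where "c = eps / sqrt (2 * real (card (- I)))"
  have "c \<ge> 0" using assms(2) by (simp add: c_def)
  obtain g d :: "real^'n" where g: "g \<in> subdifferential (\<lambda>x. lam * l1_norm x) w"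
    and d: "infnorm d \<le> 1" and eq: "- (transpose A *v u) $ j = (g + c *\<^sub>R d) $ j"
    using assms(3,5) unfolding violated_def c_def by blast
  have "\<bar>d $ j\<bar> \<le> 1" using component_le_infnorm_cart[of d j] d by simp
  then have "\<bar>c * d $ j\<bar> \<le> c"
    using mult_left_mono[of "\<bar>d $ j\<bar>" 1 c] \<open>c \<ge> 0\<close> by (simp add: abs_mult)
  moreover have "\<bar>g $ j\<bar> \<le> lam"
    using abs_subdifferential_l1_norm_le[OF g assms(4)] .
  ultimately show ?thesis
    using \<open>c \<ge> 0\<close> unfolding abs_soft_threshold[OF assms(1)] eq c_def[symmetric] by simp
qed

lemma matrix_vector_mult_extension:
  fixes A :: "real^'n^'m"
  shows "A *v (\<chi> j. if j \<in> I then z j else 0) = (\<Sum>j\<in>I. z j *\<^sub>R column j A)"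
proof -
  have "A *v (\<chi> j. if j \<in> I then z j else 0)
      = (\<Sum>j\<in>UNIV. if j \<in> I then z j *\<^sub>R column j A else 0)"
    unfolding matrix_mult_sum by (intro sum.cong) (auto simp: scalar_mult_eq_scaleR)
  then show ?thesis by (simp add: sum.If_cases)
qed

text \<open>Stated for \<open>v*\<close> because the simplifier rewrites
  \<open>transpose A *v u\<close> to \<open>u v* A\<close>.\<close>

lemma vector_matrix_mult_component:
  fixes A :: "real^'n^'m"
  shows "(u v* A) $ j = column j A \<bullet> u"
  by (simp add: vector_matrix_mult_def column_def inner_vec_def mult.commute)

text \<open>Extending \<open>z\<close> by zero leaves \<open>A *v w\<close> equal to the reduced
  product, so the two residuals differ only in the proximal term.\<close>

lemma kkt_res_extension_le:
  fixes A :: "real^'n^'m"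
  assumes "lam \<ge> 0" "eps \<ge> 0"
    and reduced: "reduced_kkt_res A b lam I z v y u \<le> eps / sqrt 2"
    and w: "w = (\<chi> j. if j \<in> I then z j else 0)"
    and none: "violated A eps lam I w u = {}"
  shows "kkt_res A b lam w v y u \<le> eps"
proof -
  define r where "r = w - prox_l1 lam (w - transpose A *v u)"
  define c where "c = eps / sqrt (2 * real (card (- I)))"
  have "eps / sqrt 2 \<le> eps"
    using assms(2) by (simp add: divide_le_eq mult_left_le_one_le mult_le_cancel_left1)
  have L2: "L2_set (\<lambda>j. z j - soft_threshold lam (z j - column j A \<bullet> u)) I \<le> eps / sqrt 2"
    using reduced by (simp add: reduced_kkt_res_def)
  have "(\<Sum>j\<in>I. (r $ j)\<^sup>2) = (L2_set (\<lambda>j. z j - soft_threshold lam (z j - column j A \<bullet> u)) I)\<^sup>2"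
    unfolding L2_set_def
    by (simp add: sum_nonneg r_def w prox_l1_def vector_matrix_mult_component)
  also have "\<dots> \<le> (eps / sqrt 2)\<^sup>2"
    using L2 by (intro power_mono) auto
  finally have inside: "(\<Sum>j\<in>I. (r $ j)\<^sup>2) \<le> eps\<^sup>2 / 2"
    by (simp add: power_divide)
  have "(r $ j)\<^sup>2 \<le> c\<^sup>2" if "j \<in> - I" for j
  proof -
    \<comment> \<open>Outside \<open>I\<close> the entry of \<open>w\<close> is 0, so
      \<open>r $ j\<close> is, up to sign, the thresholded value of
      \<open>- (transpose A *v u) $ j\<close>.\<close>
    have "\<bar>r $ j\<bar> \<le> c"
      using abs_soft_threshold_not_violated[OF assms(1,2), of j I w A u] that none
      by (simp add: r_def w prox_l1_def c_def)
    then show ?thesis by (simp add: abs_le_square_iff[symmetric])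
  qed
  then have "(\<Sum>j\<in>- I. (r $ j)\<^sup>2) \<le> real (card (- I)) * c\<^sup>2"
    by (rule sum_bounded_above)
  \<comment> \<open>Equality unless \<open>I = UNIV\<close>, where the cardinality is 0 and the left
    side vanishes.\<close>
  also have "\<dots> \<le> eps\<^sup>2 / 2"
    by (simp add: c_def power_divide)
  finally have outside: "(\<Sum>j\<in>- I. (r $ j)\<^sup>2) \<le> eps\<^sup>2 / 2" .
  have "(norm r)\<^sup>2 = (\<Sum>j\<in>UNIV. (r $ j)\<^sup>2)"
    by (simp add: norm_vec_def L2_set_def sum_nonneg)
  also have "\<dots> = (\<Sum>j\<in>I. (r $ j)\<^sup>2) + (\<Sum>j\<in>- I. (r $ j)\<^sup>2)"
    using sum.union_disjoint[of I "- I" "\<lambda>j. (r $ j)\<^sup>2"] by simp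
  also have "\<dots> \<le> eps\<^sup>2" using inside outside by linarith
  finally have "norm r \<le> eps" using assms(2) by (rule power2_le_imp_le)
  moreover have "A *v w = (\<Sum>j\<in>I. z j *\<^sub>R column j A)"
    unfolding w by (rule matrix_vector_mult_extension)
  ultimately show ?thesis
    using reduced \<open>eps / sqrt 2 \<le> eps\<close> by (simp add: kkt_res_def reduced_kkt_res_def r_def)
qed

lemma sieve_stage_terminates:
  fixes A :: "real^'n^'m"
  assumes "lam \<ge> 0" "eps \<ge> 0" and accurate: "accurate_solver A b (eps / sqrt 2) solve lam"
  obtains s where "sieve_stage A b eps solve I lam = Some s"
    and "kkt_res A b lam (w_of s) (v_of s) (y_of s) (u_of s) \<le> eps"
proof -
  \<comment> \<open>The invariant says that the state is a solver answer for some round and index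
    set; this is what makes the accuracy assumption available in every round.\<close>
  let ?P = "\<lambda>s. \<exists>l I. s = sieve_solve solve lam l I"
  let ?above = "\<lambda>s. kkt_res A b lam (w_of s) (v_of s) (y_of s) (u_of s) > eps"
  have "\<exists>t. while_option ?above (sieve_step A eps solve lam) (sieve_solve solve lam 0 I) = Some t"
  proof (rule measure_while_option_Some[where P = ?P and f = "\<lambda>s. card (- index_of s)"])
    fix s assume "?P s" and above: "?above s"
    let ?V = "violated A eps lam (index_of s) (w_of s) (u_of s)"
    obtain l J where s: "s = sieve_solve solve lam l J" using \<open>?P s\<close> by blast
    obtain z v y u where zvyu: "solve lam l J = (z, v, y, u)" by (cases "solve lam l J")
    have "reduced_kkt_res A b lam J z v y u \<le> eps / sqrt 2"
      using accurate zvyu unfolding accurate_solver_def by (auto dest!: spec[of _ l] spec[of _ J])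
    \<comment> \<open>Contrapositive of \<open>kkt_res_extension_le\<close>: with no violated index
      the loop would already have stopped.\<close>
    with above have "?V \<noteq> {}"
      using kkt_res_extension_le[OF assms(1,2), of A b J z v y u] zvyu
      by (force simp: s sieve_solve_def)
    moreover have "?V \<subseteq> - index_of s" by (auto simp: violated_def)
    ultimately have "- (index_of s \<union> ?V) \<subset> - index_of s" by blast
    then have "card (- (index_of s \<union> ?V)) < card (- index_of s)"
      by (intro psubset_card_mono) auto
    moreover have "index_of (sieve_step A eps solve lam s) = index_of s \<union> ?V"
      by (simp add: sieve_step_def sieve_solve_def split: prod.split)
    ultimately show "?P (sieve_step A eps solve lam s) \<and>
        card (- index_of (sieve_step A eps solve lam s)) < card (- index_of s)"
      by (auto simp: sieve_step_def)
  qed blast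
  then obtain s where s: "sieve_stage A b eps solve I lam = Some s"
    unfolding sieve_stage_def by blast
  moreover have "\<not> ?above s"
    \<comment> \<open>The bound on the final residual is just the negated loop condition.\<close>
    using while_option_stop[OF s[unfolded sieve_stage_def]] .
  ultimately show thesis using that by simp
qed

lemma adaptive_sieving_terminates:
  fixes A :: "real^'n^'m"
  assumes "\<forall>lam \<in> set lams. lam \<ge> 0" "eps \<ge> 0"
    and "\<forall>lam \<in> set lams. accurate_solver A b (eps / sqrt 2) solve lam"
  shows "\<exists>path. adaptive_sieving A b eps solve I lams = Some path \<and>
           list_all2 (\<lambda>lam s. kkt_res A b lam (w_of s) (v_of s) (y_of s) (u_of s) \<le> eps) lams path"
  using assms(1,3)
\<comment> \<open>\<open>I\<close> is generalized because each stage starts from the index set on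
  which the previous one ended.\<close>
proof (induction lams arbitrary: I)
  case Nil
  then show ?case by simp
next
  case (Cons lam lams)
  then obtain s where s: "sieve_stage A b eps solve I lam = Some s"
    and "kkt_res A b lam (w_of s) (v_of s) (y_of s) (u_of s) \<le> eps"
    using sieve_stage_terminates[OF _ assms(2), of lam A b solve I] by auto
  moreover obtain path where "adaptive_sieving A b eps solve (index_of s) lams = Some path"
    and "list_all2 (\<lambda>lam s. kkt_res A b lam (w_of s) (v_of s) (y_of s) (u_of s) \<le> eps) lams path"
    using Cons.IH[of "index_of s"] Cons.prems by auto
  ultimately show ?case by simp
qed

theorem theorem5:
  fixes A :: "real^'n^'m" and b :: "real^'m" and lams :: "real list" and eps :: real
    and I0 :: "'n set" and solve :: "('n, 'm) reduced_solver"
  assumes labels: "\<forall>k. b $ k \<in> {-1, 1}"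
    and decreasing: "sorted_wrt (>) lams"
    and positive: "\<forall>lam \<in> set lams. lam > 0"
    and solvable: "\<forall>lam \<in> set lams. solution_set A b lam \<noteq> {} \<and> compact (solution_set A b lam)"
    and tolerance: "eps > 0"
    and accurate: "\<forall>lam \<in> set lams. accurate_solver A b (eps / sqrt 2) solve lam"
  shows "\<exists>path. adaptive_sieving A b eps solve I0 lams = Some path \<and>
           length path = length lams \<and>
           (\<forall>i < length lams. \<exists>u.
              kkt_res A b (lams ! i) (w_of (path ! i)) (v_of (path ! i)) (y_of (path ! i)) u \<le> eps)"
proof -
  obtain path where "adaptive_sieving A b eps solve I0 lams = Some path"
    and "list_all2 (\<lambda>lam s. kkt_res A b lam (w_of s) (v_of s) (y_of s) (u_of s) \<le> eps) lams path"
    using adaptive_sieving_terminates[of lams eps A b solve I0] positive tolerance accurate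
    by (auto simp: less_imp_le)
  then show ?thesis
    \<comment> \<open>The witness for \<open>u\<close> is \<open>u_of (path ! i)\<close>, the dual
      vector in the final state of that stage.\<close>
    by (auto simp: list_all2_conv_all_nth)
qed

end
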